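(* Let $m>1$, $d\ge 1$, and let $\sigma_1,\ldots,\sigma_d\in S_m$. Then there exist constants $c_2>c_1>0$ (depending on the $\sigma_i$) such that for all positive integers $n$, \[c_1^n\, n^{n\frac{d^2-1}{d}}\leq S_n^d(\sigma_1,\ldots,\sigma_d)\leq c_2^n\, n^{n\frac{d^2-1}{d}}.\]
   Context: A $d$-tuple $(\tau_1,\ldots,\tau_d)$ of permutations in $S_n$ contains $(\sigma_1,\ldots,\sigma_d)$ (permutations in $S_m$) in parallel if there exist indices $c_1<\cdots<c_m$ in $[n]$ such that for each $i\in[d]$ the sequence $\tau_i(c_1)\cdots\tau_i(c_m)$ is order-isomorphic to $\sigma_i$; otherwise it avoids it in parallel. $S_n^d(\sigma_1,\ldots,\sigma_d)$ denotes the number of $d$-tuples $(\tau_1,\ldots,\tau_d)\in S_n^d$ that avoid $(\sigma_1,\ldots,\sigma_d)$ in parallel. *)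

theory Defs
  imports Complex_Main "HOL-Library.FuncSet" "HOL-Combinatorics.Permutations"
begin

(* Permutations in S_n are functions on nat with "p permutes {1..n}". A d-tuple of them is an
   extensional function on the index set {1..d}, so that distinct tuples are distinct functions. *)

definition perm_tuples :: "nat \<Rightarrow> nat \<Rightarrow> (nat \<Rightarrow> nat \<Rightarrow> nat) set" where
  "perm_tuples d n = ({1..d} \<rightarrow>\<^sub>E {p. p permutes {1..n}})"

(* The sequences s 1, ..., s m and t 1, ..., t m; values outside {1..m} are irrelevant. *)

definition order_isomorphic :: "nat \<Rightarrow> (nat \<Rightarrow> nat) \<Rightarrow> (nat \<Rightarrow> nat) \<Rightarrow> bool" where
  "order_isomorphic m s t \<longleftrightarrow> (\<forall>a\<in>{1..m}. \<forall>b\<in>{1..m}. s a < s b \<longleftrightarrow> t a < t b)"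

definition contains_in_parallel ::
  "nat \<Rightarrow> nat \<Rightarrow> (nat \<Rightarrow> nat \<Rightarrow> nat) \<Rightarrow> nat \<Rightarrow> (nat \<Rightarrow> nat \<Rightarrow> nat) \<Rightarrow> bool" where
  "contains_in_parallel d n \<tau> m \<sigma> \<longleftrightarrow>
     (\<exists>c. strict_mono_on {1..m} c \<and> c ` {1..m} \<subseteq> {1..n} \<and>
          (\<forall>i\<in>{1..d}. order_isomorphic m (\<lambda>j. \<tau> i (c j)) (\<sigma> i)))"

definition num_avoiding :: "nat \<Rightarrow> nat \<Rightarrow> nat \<Rightarrow> (nat \<Rightarrow> nat \<Rightarrow> nat) \<Rightarrow> nat" where
  "num_avoiding d n m \<sigma> = card {\<tau> \<in> perm_tuples d n. \<not> contains_in_parallel d n \<tau> m \<sigma>}"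

end

theory Submission
  imports Defs
begin

text \<open>
  A tuple \<open>(\<tau>\<^sub>1, \<dots>, \<tau>\<^sub>d)\<close> is the set of the \<open>n\<close> points
  \<open>(c, \<tau>\<^sub>1(c), \<dots>, \<tau>\<^sub>d(c))\<close> in dimension \<open>d + 1\<close>; write \<open>K\<close> for a power of two of
  order \<open>n\<^bsup>1/d\<^esup>\<close>.

  Upper bound. By the higher-dimensional Marcus--Tardos theorem of Klazar and Marcus, a
  pattern-avoiding subset of a grid of side \<open>K\<close> has \<open>O(K\<^sup>d) = O(n)\<close> elements, and Klazar's
  doubling argument shows that there are only \<open>2\<^bsup>O(n)\<^esup>\<close> such subsets. The cells of side
  \<open>s \<approx> n/K\<close> that meet an avoiding point set form one of these subsets, after which the \<open>n\<close>
  points are chosen among \<open>O(n s\<^bsup>d+1\<^esup>)\<close> positions. This leaves at most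
  \<open>C\<^sup>n s\<^bsup>n(d+1)\<^esup>\<close> possibilities, and \<open>s\<^bsup>d+1\<^esup>\<close> is of order \<open>n\<^bsup>(d*d-1)/d\<^esup>\<close>.

  Lower bound. It suffices to avoid the first two entries of the pattern. Up to reversing
  directions, take \<open>n\<close> cells on a hyperplane of constant coordinate sum, an antichain, in a
  grid of side \<open>O(K)\<close>, and put one point into each; breaking the ties between equal cell
  coordinates arbitrarily gives at least \<open>(c n/K)\<^sup>n\<close> choices in each of the \<open>d + 1\<close> directions.
\<close>

section \<open>Counting by fibres, powers and increasing sequences\<close>

lemma card_le_card_mult_fibres:
  assumes "finite S" "finite T" "f ` S \<subseteq> T"
    and "\<And>y. y \<in> T \<Longrightarrow> card {x \<in> S. f x = y} \<le> b"
  shows "card S \<le> card T * b"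
proof -
  have "S = (\<Union>y\<in>T. {x \<in> S. f x = y})"
    using assms(3) by auto
  then have "card S \<le> (\<Sum>y\<in>T. card {x \<in> S. f x = y})"
    using card_UN_le[OF assms(2)] by metis
  also have "\<dots> \<le> (\<Sum>y\<in>T. b)"
    by (rule sum_mono) (use assms(4) in auto)
  finally show ?thesis
    by simp
qed

lemma power_between:
  fixes t N :: nat
  assumes "t \<ge> 2" "N \<ge> 1"
  obtains e where "N \<le> t ^ e" "t ^ e \<le> t * N"
proof -
  define e where "e = (LEAST e. N \<le> t ^ e)"
  have "N < t ^ N"
    by (rule less_le_trans[OF less_exp power_mono]) (use assms in auto)
  then have e: "N \<le> t ^ e"
    unfolding e_def by (intro LeastI[of "\<lambda>e. N \<le> t ^ e" N] less_imp_le)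
  show ?thesis
  proof (cases e)
    case 0
    then show ?thesis
      using that[of e] e assms by auto
  next
    case (Suc e')
    then have "\<not> N \<le> t ^ e'"
      using not_less_Least[of e' "\<lambda>e. N \<le> t ^ e"] unfolding e_def by auto
    then show ?thesis
      using that[of e] e Suc by auto
  qed
qed

lemma strict_mono_on_into_nat_set:
  fixes V :: "nat set"
  assumes "finite V" "k \<le> card V"
  obtains v where "strict_mono_on {..<k} v" "v ` {..<k} \<subseteq> V"
proof
  let ?v = "\<lambda>j. sorted_list_of_set V ! j"
  show "strict_mono_on {..<k} ?v"
    using assms by (auto intro!: strict_mono_onI sorted_wrt_nth_less[OF strict_sorted_list_of_set])
  show "?v ` {..<k} \<subseteq> V"
    using assms nth_mem[of _ "sorted_list_of_set V"] by auto
qed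

section \<open>Pattern-avoiding subsets of a grid\<close>

text \<open>The pattern enters only through its rank functions \<open>w i\<close>, and equal ranks
  impose nothing. The set \<open>I\<close> is a parameter because the Klazar-Marcus induction
  removes directions one at a time.\<close>

definition has_pattern :: "'i set \<Rightarrow> 'j set \<Rightarrow> ('i \<Rightarrow> 'j \<Rightarrow> nat) \<Rightarrow> ('i \<Rightarrow> nat) set \<Rightarrow> bool" where
  "has_pattern I J w A \<longleftrightarrow>
     (\<exists>a. a ` J \<subseteq> A \<and> (\<forall>i\<in>I. \<forall>j\<in>J. \<forall>l\<in>J. w i j < w i l \<longrightarrow> a j i < a l i))"

definition block :: "'i set \<Rightarrow> nat \<Rightarrow> ('i \<Rightarrow> nat) \<Rightarrow> 'i \<Rightarrow> nat" where
  "block I t x = (\<lambda>i\<in>I. x i div t)"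

abbreviation grid :: "'i set \<Rightarrow> nat \<Rightarrow> ('i \<Rightarrow> nat) set" where
  "grid I N \<equiv> I \<rightarrow>\<^sub>E {..<N}"

lemma card_grid: "finite I \<Longrightarrow> card (grid I N) = N ^ card I"
  by (simp add: card_PiE)

lemma finite_grid: "finite I \<Longrightarrow> finite (grid I N)"
  by (simp add: finite_PiE)

lemma block_in_grid:
  assumes "x \<in> grid I n" "n \<le> t * N"
  shows "block I t x \<in> grid I N"
proof -
  have "x i div t < N" if "i \<in> I" for i
  proof -
    have "x i < N * t"
      using assms that by (auto simp: mult.commute dest!: PiE_mem[where x = i])
    then show ?thesis
      by (rule less_mult_imp_div_less)
  qed
  then show ?thesis
    by (auto simp: block_def)
qed

text \<open>Strictly increasing quotients come from strictly increasing numbers, so any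
  representatives of the blocks show the pattern. This lets avoidance pass to coarser grids.\<close>

lemma has_pattern_of_blocks:
  assumes "has_pattern I J w (block I t ` A)"
  shows "has_pattern I J w A"
proof -
  obtain a where a: "a ` J \<subseteq> block I t ` A"
      "\<forall>i\<in>I. \<forall>j\<in>J. \<forall>l\<in>J. w i j < w i l \<longrightarrow> a j i < a l i"
    using assms unfolding has_pattern_def by blast
  have "\<forall>j\<in>J. \<exists>x\<in>A. a j = block I t x"
    using a(1) by auto
  then obtain x where x: "\<And>j. j \<in> J \<Longrightarrow> x j \<in> A" "\<And>j. j \<in> J \<Longrightarrow> a j = block I t (x j)"
    by metis
  have "x j i < x l i" if "i \<in> I" "j \<in> J" "l \<in> J" "w i j < w i l" for i j l
  proof -
    have "x j i div t < x l i div t"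
      using a(2) that x(2) by (auto simp: block_def)
    then show ?thesis
      by (meson div_le_mono leD not_le_imp_less)
  qed
  then show ?thesis
    unfolding has_pattern_def using x(1) by (intro exI[of _ x]) auto
qed

lemma inj_on_mod_fibre:
  "inj_on (\<lambda>x. \<lambda>i\<in>I. x i mod t) {x \<in> grid I n. block I t x = B}"
proof (rule inj_onI)
  fix x y
  assume x: "x \<in> {x \<in> grid I n. block I t x = B}" and y: "y \<in> {x \<in> grid I n. block I t x = B}"
    and eq: "(\<lambda>i\<in>I. x i mod t) = (\<lambda>i\<in>I. y i mod t)"
  have "x i = y i" if "i \<in> I" for i
  proof -
    have "x i div t = y i div t"
      using x y that by (auto simp: block_def dest!: fun_cong[where x = i] split: if_splits)
    moreover have "x i mod t = y i mod t"
      using fun_cong[OF eq, of i] that by simp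
    ultimately show ?thesis
      by (metis div_mult_mod_eq)
  qed
  then show "x = y"
    using x y by (auto intro: PiE_ext)
qed

lemma card_block_fibre:
  assumes "finite I" "t \<ge> 1"
  shows "card {x \<in> grid I n. block I t x = B} \<le> t ^ card I"
proof -
  have "card {x \<in> grid I n. block I t x = B} \<le> card (grid I t)"
    using assms by (intro card_inj_on_le[OF inj_on_mod_fibre]) (auto simp: finite_PiE)
  then show ?thesis
    using assms by (simp add: card_grid)
qed

lemma card_block_vimage:
  assumes "finite I" "t \<ge> 1" "finite A"
  shows "card {x \<in> grid I n. block I t x \<in> A} \<le> card A * t ^ card I"
proof (rule card_le_card_mult_fibres[where f = "block I t"])
  fix B assume "B \<in> A"
  then have "{x \<in> {x \<in> grid I n. block I t x \<in> A}. block I t x = B} = {x \<in> grid I n. block I t x = B}"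
    by auto
  then show "card {x \<in> {x \<in> grid I n. block I t x \<in> A}. block I t x = B} \<le> t ^ card I"
    using card_block_fibre[OF assms(1,2), of n B] by simp
qed (use assms in \<open>auto simp: finite_grid\<close>)

section \<open>Size of avoiding sets (Klazar and Marcus)\<close>

lemma card_avoiding_singleton:
  assumes w: "\<forall>j\<in>J. w i j < k"
    and A: "A \<subseteq> grid {i} N" "\<not> has_pattern {i} J w A"
  shows "card A \<le> k"
proof (rule ccontr)
  assume "\<not> card A \<le> k"
  moreover have "inj_on (\<lambda>x. x i) A"
    using A(1) by (intro inj_onI PiE_ext[of _ "{i}"]) auto
  moreover have "finite A"
    using A(1) finite_subset[OF _ finite_grid] by blast
  ultimately have "finite ((\<lambda>x. x i) ` A)" "k \<le> card ((\<lambda>x. x i) ` A)"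
    by (auto simp: card_image)
  then obtain v where v: "strict_mono_on {..<k} v" "v ` {..<k} \<subseteq> (\<lambda>x. x i) ` A"
    by (rule strict_mono_on_into_nat_set)
  have "\<forall>j\<in>{..<k}. \<exists>x\<in>A. v j = x i"
    using v(2) by blast
  then obtain x where x: "\<And>j. j < k \<Longrightarrow> x j \<in> A" "\<And>j. j < k \<Longrightarrow> v j = x j i"
    by (metis lessThan_iff)
  \<comment> \<open>Entry \<open>j\<close> of the pattern takes the point of rank
    \<open>w i j\<close> in an increasing list of \<open>k\<close> points.\<close>
  have "has_pattern {i} J w A"
    unfolding has_pattern_def
    by (rule exI[of _ "\<lambda>j. x (w i j)"])
       (use w x v(1) in \<open>auto simp flip: x(2) intro: strict_mono_onD[OF v(1)]\<close>)
  with A(2) show False ..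
qed

text \<open>
  Blocks in a common slab whose points show the same set \<open>S\<close> of at least \<open>k\<close> offsets in
  direction \<open>i\<close> avoid the pattern with direction \<open>i\<close> removed: the order required in
  direction \<open>i\<close> can always be realised by picking offsets inside the blocks.
\<close>

lemma not_has_pattern_wide_blocks:
  assumes w: "\<forall>j\<in>J. w i j < k" and i: "i \<in> I"
    and A: "A \<subseteq> grid I n" "\<not> has_pattern I J w A"
    and S: "finite S" "k \<le> card S"
    and Q: "\<And>B. B \<in> Q \<Longrightarrow> B i = v \<and> S \<subseteq> (\<lambda>x. x i mod t) ` {x \<in> A. block I t x = B}"
  shows "\<not> has_pattern (I - {i}) J w ((\<lambda>B. restrict B (I - {i})) ` Q)"
proof
  assume "has_pattern (I - {i}) J w ((\<lambda>B. restrict B (I - {i})) ` Q)"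
  then obtain a where a: "a ` J \<subseteq> (\<lambda>B. restrict B (I - {i})) ` Q"
      "\<forall>i'\<in>I - {i}. \<forall>j\<in>J. \<forall>l\<in>J. w i' j < w i' l \<longrightarrow> a j i' < a l i'"
    unfolding has_pattern_def by blast
  have "\<forall>j\<in>J. \<exists>B\<in>Q. a j = restrict B (I - {i})"
    using a(1) by auto
  then obtain B where B: "\<And>j. j \<in> J \<Longrightarrow> B j \<in> Q" "\<And>j. j \<in> J \<Longrightarrow> a j = restrict (B j) (I - {i})"
    by metis
  obtain s where s: "strict_mono_on {..<k} s" "s ` {..<k} \<subseteq> S"
    using strict_mono_on_into_nat_set[OF S] .
  have "\<exists>x. x \<in> A \<and> block I t x = B j \<and> x i mod t = s (w i j)" if "j \<in> J" for j
  proof -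
    have "s (w i j) \<in> S"
      using that w s(2) by auto
    then have "s (w i j) \<in> (\<lambda>x. x i mod t) ` {x \<in> A. block I t x = B j}"
      using Q[OF B(1)[OF that]] by (meson subsetD)
    then show ?thesis
      by auto
  qed
  then obtain x where x: "\<And>j. j \<in> J \<Longrightarrow> x j \<in> A" "\<And>j. j \<in> J \<Longrightarrow> block I t (x j) = B j"
      "\<And>j. j \<in> J \<Longrightarrow> x j i mod t = s (w i j)"
    by metis
  have div: "x j i' div t = B j i'" if "j \<in> J" "i' \<in> I" for j i'
    using x(2)[OF that(1), symmetric] that(2) by (simp add: block_def)
  \<comment> \<open>In direction \<open>i\<close> all blocks share the coordinate \<open>v\<close>,
    so the chosen offsets decide; elsewhere the blocks themselves are already in order.\<close>
  have "x j i' < x l i'" if "i' \<in> I" "j \<in> J" "l \<in> J" "w i' j < w i' l" for i' j l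
  proof (cases "i' = i")
    case True
    have "x j i div t = x l i div t"
      using div i Q B(1) that by metis
    moreover have "x j i mod t < x l i mod t"
      using x(3) that True w by (auto intro: strict_mono_onD[OF s(1)])
    ultimately show ?thesis
      using True by (metis add_less_cancel_left mult_div_mod_eq)
  next
    case False
    then have "a j i' < a l i'"
      using a(2) that by auto
    then have "x j i' div t < x l i' div t"
      using B(2) div that False by auto
    then show ?thesis
      by (meson div_le_mono leD not_le_imp_less)
  qed
  then have "has_pattern I J w A"
    unfolding has_pattern_def using x(1) by (intro exI[of _ x]) auto
  with A(2) show False ..
qed


text \<open>Group the wide blocks by their slab \<open>B i\<close> and their offset set
  \<open>S B\<close>, which leaves at most \<open>N * 2 ^ t\<close> classes. Dropping direction
  \<open>i\<close> is injective on a class, because \<open>B i\<close> is fixed there, and the image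
  avoids the reduced pattern.\<close>

lemma card_wide_blocks:
  fixes N C :: nat
  assumes w: "\<forall>j\<in>J. w i j < k" and I: "finite I" "i \<in> I" "card I \<ge> 2"
    and A: "A \<subseteq> grid I (t * N)" "\<not> has_pattern I J w A"
    and C: "\<And>A. A \<subseteq> grid (I - {i}) N \<Longrightarrow> \<not> has_pattern (I - {i}) J w A \<Longrightarrow>
              card A \<le> C * N ^ (card I - 2)"
  defines "S \<equiv> \<lambda>B. (\<lambda>x. x i mod t) ` {x \<in> A. block I t x = B}"
  assumes t: "t \<ge> 1"
  shows "card {B \<in> block I t ` A. k \<le> card (S B)} \<le> 2 ^ t * C * N ^ (card I - 1)"
proof -
  let ?W = "{B \<in> block I t ` A. k \<le> card (S B)}"
  have block: "block I t x \<in> grid I N" if "x \<in> A" for x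
    using block_in_grid[of x I "t * N" t N] A(1) that by auto
  have "finite A"
    using A(1) I(1) finite_grid finite_subset by blast
  have S: "S B \<subseteq> {..<t}" for B
    using t by (auto simp: S_def)
  have "card ?W \<le> card ({..<N} \<times> Pow {..<t}) * (C * N ^ (card I - 2))"
  proof (rule card_le_card_mult_fibres[where f = "\<lambda>B. (B i, S B)"])
    show "(\<lambda>B. (B i, S B)) ` ?W \<subseteq> {..<N} \<times> Pow {..<t}"
      using block I(2) S by (auto dest: PiE_mem)
    fix y assume "y \<in> {..<N} \<times> Pow {..<t}"
    obtain v T where y: "y = (v, T)"
      by fastforce
    let ?Q = "{B \<in> ?W. (B i, S B) = y}"
    let ?r = "\<lambda>B. restrict B (I - {i})"
    have inj: "inj_on ?r ?Q"
    proof (rule inj_onI)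
      fix B B' assume B: "B \<in> ?Q" "B' \<in> ?Q" and eq: "?r B = ?r B'"
      have grid: "B \<in> grid I N" "B' \<in> grid I N"
        using B block by auto
      have "B j = B' j" if "j \<in> I" for j
        using B y fun_cong[OF eq, of j] that by (cases "j = i") auto
      then show "B = B'"
        using grid by (auto intro: PiE_ext)
    qed
    show "card ?Q \<le> C * N ^ (card I - 2)"
    proof (cases "?Q = {}")
      case False
      then have T: "k \<le> card T"
        using y by auto
      have "finite T"
        using False y S finite_subset[of T "{..<t}"] by auto
      then have "\<not> has_pattern (I - {i}) J w (?r ` ?Q)"
        by (rule not_has_pattern_wide_blocks[OF w I(2) A _ T, where v = v and t = t])
           (auto simp: y S_def)
      moreover have "?r ` ?Q \<subseteq> grid (I - {i}) N"
      proof (rule image_subsetI)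
        fix B assume "B \<in> ?Q"
        then have "B \<in> grid I N"
          using block by auto
        then show "?r B \<in> grid (I - {i}) N"
          by (auto dest: PiE_mem)
      qed
      ultimately have "card (?r ` ?Q) \<le> C * N ^ (card I - 2)"
        by (intro C)
      then show ?thesis
        using card_image[OF inj] by simp
    next
      case True
      then show ?thesis
        by (simp only: card.empty le0)
    qed
  qed (use \<open>finite A\<close> in auto)
  moreover have "N ^ (card I - 1) = N * N ^ (card I - 2)"
    using I(3) by (metis Suc_diff_le diff_Suc_Suc numeral_2_eq_2 One_nat_def power_Suc)
  ultimately show ?thesis
    by (simp add: card_cartesian_product card_Pow mult_ac)
qed

text \<open>A block that is wide in no direction has fewer than \<open>k\<close> offsets in each, so
  it holds at most \<open>k ^ card I\<close> points. Wide blocks may hold up to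
  \<open>t ^ card I\<close> points, but \<open>card_wide_blocks\<close> makes them few.\<close>

lemma card_avoiding_step:
  fixes N E :: nat
  assumes I: "finite I" "card I \<ge> 2"
    and w: "\<forall>i\<in>I. \<forall>j\<in>J. w i j < k"
    and A: "A \<subseteq> grid I (t * N)" "\<not> has_pattern I J w A"
    and C: "\<And>i A. i \<in> I \<Longrightarrow> A \<subseteq> grid (I - {i}) N \<Longrightarrow> \<not> has_pattern (I - {i}) J w A \<Longrightarrow>
              card A \<le> C i * N ^ (card I - 2)"
    and t: "t \<ge> 1"
  shows "card A \<le> card (block I t ` A) * k ^ card I
           + (\<Sum>i\<in>I. 2 ^ t * C i) * t ^ card I * N ^ (card I - 1)"
proof -
  define S where "S i B = (\<lambda>x. x i mod t) ` {x \<in> A. block I t x = B}" for i B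
  let ?W = "\<lambda>i. {B \<in> block I t ` A. k \<le> card (S i B)}"
  let ?U = "\<Union>i\<in>I. ?W i"
  have fin: "finite A"
    using A(1) I(1) finite_grid finite_subset by blast
  have fibre: "{x \<in> A. block I t x = B} \<subseteq> {x \<in> grid I (t * N). block I t x = B}" for B
    using A(1) by auto
  have wide: "card (?W i) \<le> 2 ^ t * C i * N ^ (card I - 1)" if "i \<in> I" for i
    unfolding S_def by (rule card_wide_blocks[OF _ I(1) that I(2) A C t]) (use w that in auto)
  have "A = {x \<in> A. block I t x \<in> block I t ` A - ?U} \<union> {x \<in> A. block I t x \<in> ?U}"
    by auto
  then have "card A \<le> card {x \<in> A. block I t x \<in> block I t ` A - ?U} + card {x \<in> A. block I t x \<in> ?U}"
    by (rule ord_eq_le_trans[OF arg_cong[where f = card] card_Un_le])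
  moreover have "card {x \<in> A. block I t x \<in> block I t ` A - ?U} \<le> card (block I t ` A - ?U) * k ^ card I"
  proof (rule card_le_card_mult_fibres[where f = "block I t"])
    fix B assume B: "B \<in> block I t ` A - ?U"
    have "card {x \<in> A. block I t x = B} \<le> card (\<Pi>\<^sub>E i\<in>I. S i B)"
    proof (rule card_inj_on_le)
      show "inj_on (\<lambda>x. \<lambda>i\<in>I. x i mod t) {x \<in> A. block I t x = B}"
        using inj_on_subset[OF inj_on_mod_fibre fibre] .
      show "finite (\<Pi>\<^sub>E i\<in>I. S i B)"
        using fin I(1) by (auto simp: S_def intro!: finite_PiE)
    qed (auto simp: S_def)
    also have "\<dots> = (\<Prod>i\<in>I. card (S i B))"
      using I(1) by (simp add: card_PiE)
    also have "\<dots> \<le> (\<Prod>i\<in>I. k)"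
      by (rule prod_mono) (use B in fastforce)
    finally have "card {x \<in> A. block I t x = B} \<le> k ^ card I"
      by simp
    moreover have "{x \<in> {x \<in> A. block I t x \<in> block I t ` A - ?U}. block I t x = B} = {x \<in> A. block I t x = B}"
      using B by blast
    ultimately show "card {x \<in> {x \<in> A. block I t x \<in> block I t ` A - ?U}. block I t x = B} \<le> k ^ card I"
      by simp
  qed (use fin in auto)
  moreover have "card (block I t ` A - ?U) \<le> card (block I t ` A)"
    using fin by (intro card_mono) auto
  moreover have "card {x \<in> A. block I t x \<in> ?U} \<le> card ?U * t ^ card I"
  proof -
    have finU: "finite ?U"
      using fin I(1) by auto
    have "card {x \<in> A. block I t x \<in> ?U} \<le> card {x \<in> grid I (t * N). block I t x \<in> ?U}"
      using A(1) finite_grid[OF I(1)] by (intro card_mono) auto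
    also have "\<dots> \<le> card ?U * t ^ card I"
      by (rule card_block_vimage[OF I(1) t finU])
    finally show ?thesis .
  qed
  moreover have "card ?U \<le> (\<Sum>i\<in>I. 2 ^ t * C i) * N ^ (card I - 1)"
  proof -
    have "card ?U \<le> (\<Sum>i\<in>I. card (?W i))"
      by (rule card_UN_le[OF I(1)])
    also have "\<dots> \<le> (\<Sum>i\<in>I. 2 ^ t * C i * N ^ (card I - 1))"
      by (rule sum_mono) (rule wide)
    finally show ?thesis
      by (simp add: sum_distrib_right)
  qed
  ultimately have "card A \<le> card (block I t ` A) * k ^ card I
      + (\<Sum>i\<in>I. 2 ^ t * C i) * N ^ (card I - 1) * t ^ card I"
    by (meson add_mono le_trans mult_le_mono1)
  then show ?thesis
    by (simp add: mult_ac)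
qed

text \<open>Induction on the set of directions; smaller sets control the wide blocks. For fixed
  \<open>I\<close>, \<open>card_avoiding_step\<close> is iterated over the sides
  \<open>t ^ e\<close>, and a general \<open>N\<close> is rounded up to such a power at the cost of
  a factor \<open>t ^ D\<close>.\<close>

theorem Klazar_Marcus:
  assumes "finite I" "I \<noteq> {}" "\<forall>i\<in>I. \<forall>j\<in>J. w i j < k"
  shows "\<exists>C. \<forall>N\<ge>1. \<forall>A. A \<subseteq> grid I N \<longrightarrow> \<not> has_pattern I J w A \<longrightarrow> card A \<le> C * N ^ (card I - 1)"
  using assms
proof (induction I rule: finite_psubset_induct)
  case (psubset I)
  show ?case
  proof (cases "card I \<ge> 2")
    case False
    then have "card I = 1"
      using psubset by (simp add: card_gt_0_iff Suc_leI le_antisym not_less_eq_eq numeral_2_eq_2)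
    then obtain i where "I = {i}"
      by (rule card_1_singletonE)
    then show ?thesis
      using card_avoiding_singleton[of J w i k] psubset.prems by (intro exI[of _ k]) auto
  next
    case True
    note I = psubset.hyps True
    define D where "D = card I - 1"
    have D: "D \<ge> 1" "card I - 2 = D - 1"
      using True by (auto simp: D_def)
    have "\<exists>C. \<forall>N\<ge>1. \<forall>A. A \<subseteq> grid (I - {i}) N \<longrightarrow> \<not> has_pattern (I - {i}) J w A \<longrightarrow>
            card A \<le> C * N ^ (card I - 2)" if "i \<in> I" for i
    proof -
      have "card (I - {i}) = card I - 1"
        using that I by simp
      then have card: "card (I - {i}) \<ge> 1" "card (I - {i}) - 1 = card I - 2"
        using I by auto
      then have "I - {i} \<noteq> {}"
        by (metis card.empty not_one_le_zero)
      then show ?thesis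
        using psubset.IH[of "I - {i}"] that psubset.prems card(2) by force
    qed
    then obtain C where C: "\<And>i N A. i \<in> I \<Longrightarrow> N \<ge> 1 \<Longrightarrow> A \<subseteq> grid (I - {i}) N \<Longrightarrow>
        \<not> has_pattern (I - {i}) J w A \<Longrightarrow> card A \<le> C i * N ^ (card I - 2)"
      by metis
    \<comment> \<open>Large enough for the recursion to gain: \<open>k ^ card I + 1 \<le> t ^ D\<close>.\<close>
    define t where "t = k ^ card I + 2"
    \<comment> \<open>\<open>E\<close> dominates the coefficient of the wide-block term; the summand
      1 pays for the one-point grid at \<open>e = 0\<close>.\<close>
    define E where "E = (\<Sum>i\<in>I. 2 ^ t * C i) * t ^ card I + 1"
    have t: "t \<ge> 1" "t \<ge> 2" "k ^ card I + 1 \<le> t ^ D"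
      using D(1) self_le_power[of t D] by (auto simp: t_def)
    have powers: "card A \<le> E * (t ^ e) ^ D"
      if "A \<subseteq> grid I (t ^ e)" "\<not> has_pattern I J w A" for e A
      using that
    proof (induction e arbitrary: A)
      case 0
      then have "card A \<le> card (grid I 1)"
        using I(1) by (intro card_mono finite_grid) auto
      then show ?case
        using I(1) by (simp add: card_grid E_def)
    next
      case (Suc e)
      have "block I t ` A \<subseteq> grid I (t ^ e)"
        using Suc.prems(1) block_in_grid[of _ I "t ^ Suc e" t "t ^ e"] by auto
      then have IH: "card (block I t ` A) \<le> E * (t ^ e) ^ D"
        using Suc.IH[of "block I t ` A"] Suc.prems(2) has_pattern_of_blocks[of I J w t A] by auto
      have "card A \<le> card (block I t ` A) * k ^ card I
              + (\<Sum>i\<in>I. 2 ^ t * C i) * t ^ card I * (t ^ e) ^ (card I - 1)"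
        by (rule card_avoiding_step[OF I psubset.prems(2) _ Suc.prems(2) _ t(1)])
           (use Suc.prems(1) C t in auto)
      also have "\<dots> \<le> E * (t ^ e) ^ D * k ^ card I + E * (t ^ e) ^ D"
        using IH by (intro add_mono mult_le_mono1) (auto simp: E_def D_def)
      also have "\<dots> = E * (t ^ e) ^ D * (k ^ card I + 1)"
        by simp
      also have "\<dots> \<le> E * (t ^ e) ^ D * t ^ D"
        using t(3) by (intro mult_le_mono2)
      also have "\<dots> = E * (t ^ Suc e) ^ D"
        by (simp add: power_mult_distrib)
      finally show ?case .
    qed
    show ?thesis
    proof (intro exI[of _ "E * t ^ D"] allI impI)
      fix N A assume N: "1 \<le> (N :: nat)" and A: "A \<subseteq> grid I N" "\<not> has_pattern I J w A"
      obtain e where e: "N \<le> t ^ e" "t ^ e \<le> t * N"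
        using power_between[OF t(2) N] .
      have "A \<subseteq> grid I (t ^ e)"
        using A(1) e(1) PiE_mono[of I "\<lambda>_. {..<N}" "\<lambda>_. {..<t ^ e}"] by auto
      then have "card A \<le> E * (t ^ e) ^ D"
        using powers A(2) by blast
      also have "\<dots> \<le> E * (t * N) ^ D"
        using e(2) by (intro mult_le_mono2 power_mono) auto
      finally show "card A \<le> E * t ^ D * N ^ (card I - 1)"
        by (simp add: power_mult_distrib D_def mult_ac)
    qed
  qed
qed

text \<open>
  Klazar's doubling argument: the avoiding subsets of a grid of side \<open>2 * N\<close> are refinements
  of avoiding subsets of a grid of side \<open>N\<close>, which have only \<open>O(N ^ (card I - 1))\<close> points.
\<close>

lemma card_avoiding_sets:
  assumes I: "finite I" "card I \<ge> 2" and w: "\<forall>i\<in>I. \<forall>j\<in>J. w i j < k"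
  shows "\<exists>L. \<forall>e. card {A. A \<subseteq> grid I (2 ^ e) \<and> \<not> has_pattern I J w A}
           \<le> 2 ^ (L * (2 ^ e) ^ (card I - 1))"
proof -
  define D where "D = card I - 1"
  have D: "D \<ge> 1"
    using I by (simp add: D_def)
  have "I \<noteq> {}"
    using I(2) by auto
  then obtain C where C: "\<And>N A. N \<ge> 1 \<Longrightarrow> A \<subseteq> grid I N \<Longrightarrow> \<not> has_pattern I J w A \<Longrightarrow> card A \<le> C * N ^ D"
    using Klazar_Marcus[OF I(1) _ w] unfolding D_def by blast
  \<comment> \<open>One refinement multiplies the count by at most \<open>2 ^ b\<close> with
    \<open>b \<le> L * (2 ^ e) ^ D\<close>, while doubling the side at least doubles the exponent,
    as \<open>D \<ge> 1\<close>. The summand 1 admits the two subsets of the one-point grid.\<close>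
  define L where "L = C * 2 ^ card I + 1"
  let ?F = "\<lambda>e. {A. A \<subseteq> grid I (2 ^ e) \<and> \<not> has_pattern I J w A}"
  have fin: "finite (?F e)" for e
    using I(1) by (intro finite_subset[OF _ finite_Pow_iff[THEN iffD2, OF finite_grid]]) auto
  have "card (?F e) \<le> 2 ^ (L * (2 ^ e) ^ D)" for e
  proof (induction e)
    case 0
    have "card (?F 0) \<le> card (Pow (grid I 1))"
      using I(1) finite_grid[of I 1] by (intro card_mono) auto
    also have "\<dots> = 2"
      using I(1) finite_grid[of I 1] by (simp add: card_Pow card_grid)
    also have "\<dots> \<le> 2 ^ L"
      by (rule self_le_power) (auto simp: L_def)
    finally show ?case
      by simp
  next
    case (Suc e)
    define b where "b = 2 ^ card I * (C * (2 ^ e) ^ D)"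
    have "card (?F (Suc e)) \<le> card (?F e) * 2 ^ b"
    proof (rule card_le_card_mult_fibres[where f = "\<lambda>A. block I 2 ` A"])
      show "(\<lambda>A. block I 2 ` A) ` ?F (Suc e) \<subseteq> ?F e"
      proof (rule image_subsetI)
        fix A assume A: "A \<in> ?F (Suc e)"
        have "block I 2 ` A \<subseteq> grid I (2 ^ e)"
          using A block_in_grid[of _ I "2 ^ Suc e" 2 "2 ^ e"] by auto
        moreover have "\<not> has_pattern I J w (block I 2 ` A)"
          using A has_pattern_of_blocks[of I J w 2 A] by auto
        ultimately show "block I 2 ` A \<in> ?F e"
          by simp
      qed
      fix B assume B: "B \<in> ?F e"
      let ?R = "{x \<in> grid I (2 ^ Suc e). block I 2 x \<in> B}"
      have finB: "finite B"
        using B I(1) finite_grid finite_subset by blast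
      have finR: "finite ?R"
        using I(1) by (intro finite_subset[OF _ finite_grid]) auto
      have "card {A \<in> ?F (Suc e). block I 2 ` A = B} \<le> card (Pow ?R)"
        using finR by (intro card_mono) auto
      also have "\<dots> = 2 ^ card ?R"
        using finR by (rule card_Pow)
      also have "\<dots> \<le> 2 ^ b"
      proof (rule power_increasing)
        have "card ?R \<le> card B * 2 ^ card I"
          using I(1) finB by (intro card_block_vimage) auto
        also have "\<dots> \<le> C * (2 ^ e) ^ D * 2 ^ card I"
          using C[of "2 ^ e" B] B by (intro mult_le_mono1) auto
        finally show "card ?R \<le> b"
          by (simp add: b_def mult_ac)
      qed simp
      finally show "card {A \<in> ?F (Suc e). block I 2 ` A = B} \<le> 2 ^ b" .
    qed (rule fin)+
    also have "\<dots> \<le> 2 ^ (L * (2 ^ e) ^ D) * 2 ^ b"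
      using Suc by (rule mult_le_mono1)
    also have "\<dots> = 2 ^ (L * (2 ^ e) ^ D + b)"
      by (simp add: power_add)
    also have "\<dots> \<le> 2 ^ (L * (2 ^ Suc e) ^ D)"
    proof (rule power_increasing)
      have "b \<le> L * (2 ^ e) ^ D"
        by (simp add: b_def L_def mult_ac)
      then have "L * (2 ^ e) ^ D + b \<le> L * (2 ^ e) ^ D * 2"
        by simp
      also have "\<dots> \<le> L * (2 ^ e) ^ D * 2 ^ D"
        using D self_le_power[of 2 D] by (intro mult_le_mono2) auto
      finally show "L * (2 ^ e) ^ D + b \<le> L * (2 ^ Suc e) ^ D"
        by (simp add: power_mult_distrib mult_ac)
    qed simp
    finally show ?case .
  qed
  then show ?thesis
    unfolding D_def by blast
qed

section \<open>Counting avoiding sets of exactly \<open>n\<close> points\<close>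

lemma power_self_le_exp_fact: "real n ^ n \<le> exp (real n) * fact n"
proof -
  \<comment> \<open>After division by \<open>fact n\<close>, the power is a single term of the
    exponential series at \<open>n\<close>.\<close>
  have "(\<Sum>k\<in>{n}. real n ^ k /\<^sub>R fact k) \<le> (\<Sum>k. real n ^ k /\<^sub>R fact k)"
    by (rule sum_le_suminf[OF summable_exp_generic]) auto
  then have "real n ^ n /\<^sub>R fact n \<le> exp (real n)"
    by (simp add: exp_def)
  then show ?thesis
    by (simp add: field_simps)
qed

text \<open>Supplies the side \<open>K = 2 ^ e\<close> for both bounds. Rounding \<open>n\<close> up
  to a power of \<open>2 ^ d\<close>, not of 2, keeps the \<open>d\<close>-th root a power of
  two.\<close>

lemma dyadic_root:
  assumes "d \<ge> 1" "n \<ge> 1"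
  obtains e where "n \<le> (2 ^ e) ^ d" "(2 ^ e) ^ d \<le> 2 ^ d * n"
    "real n powr (1 / real d) \<le> 2 ^ e" "2 ^ e \<le> 2 * real n powr (1 / real d)"
proof -
  have "2 \<le> (2 :: nat) ^ d"
    using assms(1) self_le_power[of 2 d] by auto
  then obtain e where e: "n \<le> (2 ^ d) ^ e" "(2 ^ d) ^ e \<le> 2 ^ d * n"
    using power_between[of "2 ^ d" n] assms(2) by blast
  then have e: "n \<le> (2 ^ e) ^ d" "(2 ^ e) ^ d \<le> 2 ^ d * n"
    by (simp_all add: mult.commute flip: power_mult)
  define r where "r = real n powr (1 / real d)"
  have r: "r \<ge> 0" "r ^ d = real n"
    using assms by (simp_all add: r_def powr_powr flip: powr_realpow')
  have "real n \<le> real ((2 ^ e) ^ d)" "real ((2 ^ e) ^ d) \<le> real (2 ^ d * n)"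
    using e by (simp_all only: of_nat_le_iff)
  then have "r ^ d \<le> (2 ^ e) ^ d" "(2 ^ e) ^ d \<le> (2 * r) ^ d"
    by (simp_all add: r power_mult_distrib)
  then have "r \<le> 2 ^ e" "2 ^ e \<le> 2 * r"
    using r(1) assms(1) power_mono_iff[of r "2 ^ e" d] power_mono_iff[of "2 ^ e" "2 * r" d] by simp_all
  then show ?thesis
    using that e by (simp add: r_def)
qed

text \<open>Each of the \<open>d + 1\<close> directions contributes, per point, a factor of order
  \<open>n / K\<close>, that is \<open>n powr (1 - 1 / d)\<close>.\<close>

lemma root_power_eq:
  assumes "d \<ge> 1" "n \<ge> 1"
  shows "(real n powr (1 - 1 / real d)) ^ ((d + 1) * n) = real n powr (real n * ((real d ^ 2 - 1) / real d))"
proof -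
  have "real ((d + 1) * n) * (1 - 1 / real d) = real n * ((real d ^ 2 - 1) / real d)"
    using assms by (simp add: field_simps power2_eq_square)
  then show ?thesis
    using assms(2) by (simp only: powr_power[of "real n"])
qed

text \<open>Send \<open>X\<close> to its set of occupied cells of side \<open>s\<close>: at most
  \<open>b\<close> outcomes, each leaving \<open>n\<close> points to choose among at most
  \<open>M * s ^ card I\<close> positions. The factor \<open>fact n\<close> turns the binomial
  coefficient into a power and later cancels the \<open>n ^ n\<close> coming from
  \<open>M\<close>.\<close>

lemma card_avoiding_n_sets_nat:
  fixes s K M b :: nat
  assumes I: "finite I" and s: "s \<ge> 1" "n \<le> s * K"
    and M: "\<And>A. A \<subseteq> grid I K \<Longrightarrow> \<not> has_pattern I J w A \<Longrightarrow> card A \<le> M"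
    and b: "card {A. A \<subseteq> grid I K \<and> \<not> has_pattern I J w A} \<le> b"
  shows "card {X. X \<subseteq> grid I n \<and> card X = n \<and> \<not> has_pattern I J w X} * fact n \<le> b * (M * s ^ card I) ^ n"
proof -
  let ?X = "{X. X \<subseteq> grid I n \<and> card X = n \<and> \<not> has_pattern I J w X}"
  let ?F = "{A. A \<subseteq> grid I K \<and> \<not> has_pattern I J w A}"
  let ?q = "(M * s ^ card I) choose n"
  have fin: "finite ?X" "finite ?F"
    using finite_grid[OF I, of n] finite_grid[OF I, of K]
    by (auto intro!: finite_subset[OF _ finite_Pow_iff[THEN iffD2]])
  have "card ?X \<le> card ?F * ?q"
  proof (rule card_le_card_mult_fibres[where f = "\<lambda>X. block I s ` X"])
    show "(\<lambda>X. block I s ` X) ` ?X \<subseteq> ?F"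
    proof (rule image_subsetI)
      fix X assume X: "X \<in> ?X"
      then have "block I s ` X \<subseteq> grid I K"
        using block_in_grid[of _ I n s K] s(2) by auto
      moreover have "\<not> has_pattern I J w (block I s ` X)"
        using X has_pattern_of_blocks[of I J w s X] by auto
      ultimately show "block I s ` X \<in> ?F"
        by simp
    qed
    fix A assume A: "A \<in> ?F"
    let ?R = "{x \<in> grid I n. block I s x \<in> A}"
    have finA: "finite A"
      using A finite_grid[OF I, of K] finite_subset by blast
    have finR: "finite ?R"
      by (intro finite_subset[OF _ finite_grid[OF I, of n]]) auto
    have "card ?R \<le> card A * s ^ card I"
      by (rule card_block_vimage[OF I s(1) finA])
    also have "\<dots> \<le> M * s ^ card I"
      using M[of A] A by (intro mult_le_mono1) auto
    finally have R: "card ?R \<le> M * s ^ card I" .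
    have "card {X \<in> ?X. block I s ` X = A} \<le> card {X. X \<subseteq> ?R \<and> card X = n}"
      using finR by (intro card_mono) auto
    also have "\<dots> = card ?R choose n"
      by (rule n_subsets[OF finR])
    also have "\<dots> \<le> ?q"
      using R by (rule binomial_right_mono)
    finally show "card {X \<in> ?X. block I s ` X = A} \<le> ?q" .
  qed (rule fin)+
  then have "card ?X * fact n \<le> b * ?q * fact n"
    using b by (meson mult_le_mono1 le_trans)
  also have "\<dots> \<le> b * (M * s ^ card I) ^ n"
    using binomial_fact_pow[of "M * s ^ card I" n] by (metis mult.assoc mult_le_mono2)
  finally show ?thesis .
qed

lemma card_avoiding_n_sets:
  assumes I: "finite I" "card I = d + 1" "d \<ge> 1" and w: "\<forall>i\<in>I. \<forall>j\<in>J. w i j < k"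
  shows "\<exists>c\<ge>0. \<forall>n\<ge>1. real (card {X. X \<subseteq> grid I n \<and> card X = n \<and> \<not> has_pattern I J w X})
           \<le> c ^ n * real n powr (real n * ((real d ^ 2 - 1) / real d))"
proof -
  have I': "I \<noteq> {}" "card I \<ge> 2" "card I - 1 = d"
    using I by auto
  obtain C where C: "\<forall>N\<ge>1. \<forall>A. A \<subseteq> grid I N \<longrightarrow> \<not> has_pattern I J w A \<longrightarrow> card A \<le> C * N ^ d"
    using Klazar_Marcus[OF I(1) I'(1) w] unfolding I'(3) ..
  obtain L where L: "\<forall>e. card {A. A \<subseteq> grid I (2 ^ e) \<and> \<not> has_pattern I J w A} \<le> 2 ^ (L * (2 ^ e) ^ d)"
    using card_avoiding_sets[OF I(1) I'(2) w] unfolding I'(3) ..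
  \<comment> \<open>The factors account in turn for the number of cell sets, the number of occupied
    cells, the estimate of \<open>n ^ n\<close> by \<open>fact n\<close>, and
    \<open>s \<le> 2 * x\<close> in \<open>d + 1\<close> directions.\<close>
  define c :: real where "c = 2 ^ (L * 2 ^ d) * (real C * 2 ^ d) * exp 1 * 2 ^ (d + 1)"
  show ?thesis
  proof (intro exI[of _ c] conjI allI impI)
    show "c \<ge> 0"
      by (simp add: c_def)
    fix n :: nat assume n: "n \<ge> 1"
    obtain e where e: "n \<le> (2 ^ e) ^ d" "(2 ^ e) ^ d \<le> 2 ^ d * n" "real n powr (1 / real d) \<le> 2 ^ e"
      using dyadic_root[OF I(3) n] .
    define x where "x = real n powr (1 - 1 / real d)"
    \<comment> \<open>The summand 1 makes \<open>2 ^ e\<close> intervals of length \<open>s\<close>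
      cover \<open>{..<n}\<close>; as \<open>x \<ge> 1\<close>, it still leaves
      \<open>s \<le> 2 * x\<close>.\<close>
    define s where "s = n div 2 ^ e + 1"
    let ?X = "{X. X \<subseteq> grid I n \<and> card X = n \<and> \<not> has_pattern I J w X}"
    have x: "x \<ge> 1"
      using n I(3) by (auto simp: x_def intro!: ge_one_powr_ge_zero)
    have s: "s \<ge> 1" "n \<le> s * 2 ^ e"
      using less_imp_le[OF dividend_less_times_div[of "2 ^ e" n]] by (simp_all add: s_def algebra_simps)
    have "real n / 2 ^ e \<le> real n / real n powr (1 / real d)"
      using e(3) n by (intro divide_left_mono) auto
    also have "\<dots> = x"
      using n by (simp add: x_def powr_diff)
    finally have "real (n div 2 ^ e) \<le> x"
      using of_nat_div_le_of_nat[of n "2 ^ e", where 'a = real] by simp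
    then have s_le: "real s \<le> 2 * x"
      using x by (simp add: s_def)
    have "card ?X * fact n \<le> 2 ^ (L * (2 ^ e) ^ d) * (C * (2 ^ e) ^ d * s ^ card I) ^ n"
      by (rule card_avoiding_n_sets_nat[OF I(1) s _ L[rule_format]]) (use C in auto)
    also have "\<dots> \<le> 2 ^ (L * (2 ^ d * n)) * (C * (2 ^ d * n) * s ^ (d + 1)) ^ n"
      unfolding I(2) using e(2) by (intro mult_le_mono power_mono power_increasing) auto
    finally have "real (card ?X * fact n) \<le> real (2 ^ (L * (2 ^ d * n)) * (C * (2 ^ d * n) * s ^ (d + 1)) ^ n)"
      by (simp only: of_nat_le_iff)
    then have "real (card ?X) * fact n \<le> 2 ^ (L * (2 ^ d * n)) * (real C * (2 ^ d * real n) * real s ^ (d + 1)) ^ n"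
      by simp
    also have "\<dots> \<le> 2 ^ (L * (2 ^ d * n)) * (real C * (2 ^ d * real n) * (2 * x) ^ (d + 1)) ^ n"
      using s_le by (intro mult_left_mono power_mono) auto
    also have "\<dots> = (2 ^ (L * 2 ^ d) * (real C * 2 ^ d) * 2 ^ (d + 1)) ^ n * x ^ ((d + 1) * n) * real n ^ n"
      unfolding mult.assoc[symmetric, of L] power_mult power_mult_distrib by (simp only: mult_ac)
    also have "\<dots> \<le> (2 ^ (L * 2 ^ d) * (real C * 2 ^ d) * 2 ^ (d + 1)) ^ n * x ^ ((d + 1) * n) * (exp (real n) * fact n)"
      using x power_self_le_exp_fact by (intro mult_left_mono) auto
    also have "\<dots> = c ^ n * x ^ ((d + 1) * n) * fact n"
      using exp_of_nat_mult[of n "1 :: real"] by (simp add: c_def power_mult_distrib)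
    finally have "real (card ?X) \<le> c ^ n * x ^ ((d + 1) * n)"
      by simp
    then show "real (card ?X) \<le> c ^ n * real n powr (real n * ((real d ^ 2 - 1) / real d))"
      unfolding x_def root_power_eq[OF I(3) n] .
  qed
qed

section \<open>Tuples of permutations as point sets\<close>

text \<open>Taking the position as direction 0 puts it on the same footing as the values;
  subtracting 1 moves \<open>{1..n}\<close> onto \<open>{..<n}\<close>.\<close>

definition point_set :: "nat \<Rightarrow> nat \<Rightarrow> (nat \<Rightarrow> nat \<Rightarrow> nat) \<Rightarrow> (nat \<Rightarrow> nat) set" where
  "point_set d n \<tau> = (\<lambda>c. \<lambda>i\<in>{0..d}. (if i = 0 then c else \<tau> i c) - 1) ` {1..n}"

lemma perm_tuplesD:
  assumes "\<tau> \<in> perm_tuples d n" "i \<in> {1..d}"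
  shows "\<tau> i permutes {1..n}"
  using PiE_mem[OF assms(1)[unfolded perm_tuples_def] assms(2)] by simp

lemma point_set_eqD:
  assumes "\<tau> \<in> perm_tuples d n" "\<tau>' \<in> perm_tuples d n" "point_set d n \<tau> = point_set d n \<tau>'"
  shows "\<tau> = \<tau>'"
proof -
  have "\<tau> i c = \<tau>' i c" if i: "i \<in> {1..d}" for i c
  proof (cases "c \<in> {1..n}")
    case True
    let ?p = "\<lambda>\<tau> c. \<lambda>i\<in>{0..d}. (if i = 0 then c else \<tau> i c) - 1"
    have "?p \<tau> c \<in> point_set d n \<tau>'"
      using True assms(3) by (auto simp: point_set_def)
    then obtain c' where c': "c' \<in> {1..n}" "?p \<tau> c = ?p \<tau>' c'"
      by (auto simp: point_set_def)
    have "c = c'"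
      using fun_cong[OF c'(2), of 0] True c'(1) by auto
    moreover have "\<tau> i c - 1 = \<tau>' i c' - 1"
      using fun_cong[OF c'(2), of i] i by auto
    \<comment> \<open>Truncated subtraction of 1 can be undone once both values are known to be
      positive.\<close>
    moreover have "\<tau> i c \<in> {1..n}" "\<tau>' i c' \<in> {1..n}"
      using True c'(1) permutes_in_image perm_tuplesD[OF _ i] assms by metis+
    ultimately show ?thesis
      by auto
  next
    case False
    then show ?thesis
      using permutes_not_in perm_tuplesD[OF _ i] assms by metis
  qed
  then have "\<tau> i = \<tau>' i" if "i \<in> {1..d}" for i
    using that by blast
  then show ?thesis
    using assms(1,2) unfolding perm_tuples_def by (rule PiE_ext[rotated 2])
qed

lemma point_set_subset_grid:
  assumes "\<tau> \<in> perm_tuples d n"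
  shows "point_set d n \<tau> \<subseteq> grid {0..d} n"
proof -
  have "\<tau> i c - 1 < n" if "i \<in> {1..d}" "c \<in> {1..n}" for i c
    using permutes_in_image[OF perm_tuplesD[OF assms that(1)], of c] that(2) by auto
  then show ?thesis
    by (fastforce simp: point_set_def)
qed

lemma card_point_set: "card (point_set d n \<tau>) = n"
proof -
  have "inj_on (\<lambda>c. \<lambda>i\<in>{0..d}. (if i = 0 then c else \<tau> i c) - 1) {1..n}"
  proof (rule inj_onI)
    fix c c'
    assume c: "c \<in> {1..n}" "c' \<in> {1..n}"
      and eq: "(\<lambda>i\<in>{0..d}. (if i = 0 then c else \<tau> i c) - 1) = (\<lambda>i\<in>{0..d}. (if i = 0 then c' else \<tau> i c') - 1)"
    show "c = c'"
      using fun_cong[OF eq, of 0] c by auto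
  qed
  then show ?thesis
    by (simp add: point_set_def card_image)
qed

text \<open>Direction 0 orders the positions; the others carry each strict inequality of
  \<open>\<sigma> i\<close> over to \<open>\<tau> i\<close>, and the converse follows because
  \<open>\<sigma> i\<close> is injective.\<close>

lemma contains_in_parallel_of_has_pattern:
  assumes \<sigma>: "\<sigma> \<in> perm_tuples d m" and \<tau>: "\<tau> \<in> perm_tuples d n"
    and pattern: "has_pattern {0..d} {1..m} (\<lambda>i j. if i = 0 then j else \<sigma> i j) (point_set d n \<tau>)"
  shows "contains_in_parallel d n \<tau> m \<sigma>"
proof -
  obtain a where a: "a ` {1..m} \<subseteq> point_set d n \<tau>"
      "\<forall>i\<in>{0..d}. \<forall>j\<in>{1..m}. \<forall>l\<in>{1..m}.
        (if i = 0 then j else \<sigma> i j) < (if i = 0 then l else \<sigma> i l) \<longrightarrow> a j i < a l i"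
    using pattern unfolding has_pattern_def by (elim exE conjE)
  have "\<forall>j\<in>{1..m}. \<exists>c\<in>{1..n}. a j = (\<lambda>i\<in>{0..d}. (if i = 0 then c else \<tau> i c) - 1)"
    using a(1) unfolding point_set_def by blast
  then obtain c where c: "\<And>j. j \<in> {1..m} \<Longrightarrow> c j \<in> {1..n}"
      "\<And>j. j \<in> {1..m} \<Longrightarrow> a j = (\<lambda>i\<in>{0..d}. (if i = 0 then c j else \<tau> i (c j)) - 1)"
    by metis
  have "c j < c l" if "j \<in> {1..m}" "l \<in> {1..m}" "j < l" for j l
  proof -
    have "a j 0 < a l 0"
      using bspec[OF a(2), of 0] that by simp
    then show ?thesis
      using c(2)[OF that(1)] c(2)[OF that(2)] by simp
  qed
  moreover have "\<tau> i (c j) < \<tau> i (c l) \<longleftrightarrow> \<sigma> i j < \<sigma> i l"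
    if i: "i \<in> {1..d}" and "j \<in> {1..m}" "l \<in> {1..m}" for i j l
  proof -
    have less: "\<tau> i (c j) < \<tau> i (c l)" if "j \<in> {1..m}" "l \<in> {1..m}" "\<sigma> i j < \<sigma> i l" for j l
    proof -
      have "a j i < a l i"
        using bspec[OF a(2), of i] that i by simp
      then show ?thesis
        using c(2)[OF that(1)] c(2)[OF that(2)] i by simp
    qed
    have "j = l" if "\<sigma> i j = \<sigma> i l"
      using permutes_inj[OF perm_tuplesD[OF \<sigma> i]] that by (simp add: inj_eq)
    then show ?thesis
      using less[of j l] less[of l j] that by (metis less_asym less_irrefl linorder_neqE_nat)
  qed
  ultimately show ?thesis
    unfolding contains_in_parallel_def order_isomorphic_def
    using c(1) by (intro exI[of _ c]) (auto intro: strict_mono_onI)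
qed

lemma num_avoiding_upper:
  assumes "d \<ge> 1" and \<sigma>: "\<sigma> \<in> perm_tuples d m"
  shows "\<exists>c\<ge>0. \<forall>n\<ge>1. real (num_avoiding d n m \<sigma>) \<le> c ^ n * real n powr (real n * ((real d ^ 2 - 1) / real d))"
proof -
  define w where "w i j = (if i = 0 then j else \<sigma> i j)" for i j
  have "w i j < m + 1" if "i \<in> {0..d}" "j \<in> {1..m}" for i j
    using permutes_in_image[OF perm_tuplesD[OF \<sigma>], of i j] that by (cases "i = 0") (auto simp: w_def)
  then have "\<exists>c\<ge>0. \<forall>n\<ge>1. real (card {X. X \<subseteq> grid {0..d} n \<and> card X = n \<and> \<not> has_pattern {0..d} {1..m} w X})
           \<le> c ^ n * real n powr (real n * ((real d ^ 2 - 1) / real d))"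
    by (intro card_avoiding_n_sets[where k = "m + 1"]) (use assms in auto)
  moreover have "num_avoiding d n m \<sigma> \<le> card {X. X \<subseteq> grid {0..d} n \<and> card X = n \<and> \<not> has_pattern {0..d} {1..m} w X}" for n
    unfolding num_avoiding_def
  proof (rule card_inj_on_le)
    show "inj_on (point_set d n) {\<tau> \<in> perm_tuples d n. \<not> contains_in_parallel d n \<tau> m \<sigma>}"
      by (intro inj_onI point_set_eqD) auto
    show "finite {X. X \<subseteq> grid {0..d} n \<and> card X = n \<and> \<not> has_pattern {0..d} {1..m} w X}"
      using finite_grid[of "{0..d}" n] by (auto intro!: finite_subset[OF _ finite_Pow_iff[THEN iffD2]])
    show "point_set d n ` {\<tau> \<in> perm_tuples d n. \<not> contains_in_parallel d n \<tau> m \<sigma>}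
        \<subseteq> {X. X \<subseteq> grid {0..d} n \<and> card X = n \<and> \<not> has_pattern {0..d} {1..m} w X}"
      using point_set_subset_grid[of _ d n] contains_in_parallel_of_has_pattern[OF \<sigma>, of _ n]
      unfolding w_def by (intro image_subsetI) (simp add: card_point_set, blast)
  qed
  ultimately show ?thesis
    by (meson of_nat_le_iff order_trans)
qed

section \<open>Tuples built from an antichain of cells\<close>

text \<open>\<open>\<rho> p\<close> is the rank of \<open>p\<close> when \<open>1, ..., n\<close>
  are listed by increasing \<open>f\<close>. Ties are left open; the lower bound counts the ways to
  break them.\<close>

definition sorting_perms :: "nat \<Rightarrow> (nat \<Rightarrow> nat) \<Rightarrow> (nat \<Rightarrow> nat) set" where
  "sorting_perms n f = {\<rho>. \<rho> permutes {1..n} \<and> (\<forall>p\<in>{1..n}. \<forall>q\<in>{1..n}. f p < f q \<longrightarrow> \<rho> p < \<rho> q)}"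

lemma finite_sorting_perms: "finite (sorting_perms n f)"
  by (rule finite_subset[OF _ finite_permutations[of "{1..n}"]]) (auto simp: sorting_perms_def)

lemma sorting_perms_nonempty: "sorting_perms n f \<noteq> {}"
proof -
  \<comment> \<open>Ties are broken by the index: \<open>card (S p)\<close> is the rank of
    \<open>p\<close> in the lexicographic order of the pairs \<open>(f p, p)\<close>.\<close>
  define S where "S p = {q \<in> {1..n}. f q < f p \<or> f q = f p \<and> q \<le> p}" for p
  define \<rho> where "\<rho> p = (if p \<in> {1..n} then card (S p) else p)" for p
  have less: "\<rho> p < \<rho> q" if "p \<in> {1..n}" "q \<in> {1..n}" "f p < f q \<or> f p = f q \<and> p < q" for p q
  proof -
    have "S p \<subseteq> S q" "q \<in> S q" "q \<notin> S p"
      using that by (auto simp: S_def)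
    then have "S p \<subset> S q"
      by blast
    moreover have "finite (S q)"
      by (simp add: S_def)
    ultimately have "card (S p) < card (S q)"
      by (rule psubset_card_mono[rotated])
    then show ?thesis
      using that by (simp add: \<rho>_def)
  qed
  have "inj_on \<rho> {1..n}"
    by (intro inj_onI) (metis less less_irrefl linorder_neqE_nat)
  moreover have "\<rho> p \<in> {1..n}" if "p \<in> {1..n}" for p
  proof -
    have "card (S p) \<le> card {1..n}"
      by (intro card_mono) (auto simp: S_def)
    moreover have "p \<in> S p" "finite (S p)"
      using that by (auto simp: S_def)
    then have "card (S p) > 0"
      using card_gt_0_iff by blast
    ultimately show ?thesis
      using that by (simp add: \<rho>_def)
  qed
  ultimately have "bij_betw \<rho> {1..n} {1..n}"
    unfolding bij_betw_def by (intro conjI endo_inj_surj) auto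
  then have "\<rho> permutes {1..n}"
    by (rule bij_imp_permutes) (auto simp: \<rho>_def)
  then have "\<rho> \<in> sorting_perms n f"
    using less by (simp add: sorting_perms_def)
  then show ?thesis
    by blast
qed

lemma sorting_perm_bounds:
  assumes \<rho>: "\<rho> \<in> sorting_perms n f" and p: "p \<in> {1..n}"
  shows "card {q \<in> {1..n}. f q < f p} < \<rho> p" "\<rho> p \<le> card {q \<in> {1..n}. f q \<le> f p}"
proof -
  have perm: "\<rho> permutes {1..n}"
    and less: "\<And>q r. q \<in> {1..n} \<Longrightarrow> r \<in> {1..n} \<Longrightarrow> f q < f r \<Longrightarrow> \<rho> q < \<rho> r"
    using \<rho> by (auto simp: sorting_perms_def)
  have range: "\<rho> q \<in> {1..n}" if "q \<in> {1..n}" for q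
    using permutes_in_image[OF perm] that by blast
  have "card {q \<in> {1..n}. f q < f p} = card (\<rho> ` {q \<in> {1..n}. f q < f p})"
    using permutes_inj_on[OF perm] by (rule card_image[symmetric])
  also have "\<dots> \<le> card {1..<\<rho> p}"
    using less[OF _ p] range by (intro card_mono) force+
  finally show "card {q \<in> {1..n}. f q < f p} < \<rho> p"
    using range[OF p] by auto
  have "{1..\<rho> p} \<subseteq> \<rho> ` {q \<in> {1..n}. f q \<le> f p}"
  proof
    fix y assume y: "y \<in> {1..\<rho> p}"
    then have "y \<in> {1..n}"
      using range[OF p] by auto
    then obtain q where q: "q \<in> {1..n}" "y = \<rho> q"
      using permutes_image[OF perm] by blast
    then have "f q \<le> f p"
      using less[OF p q(1)] y by force
    then show "y \<in> \<rho> ` {q \<in> {1..n}. f q \<le> f p}"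
      using q by blast
  qed
  then have "card {1..\<rho> p} \<le> card {q \<in> {1..n}. f q \<le> f p}"
    by (intro surj_card_le) auto
  then show "\<rho> p \<le> card {q \<in> {1..n}. f q \<le> f p}"
    by simp
qed

text \<open>The ranks given to one value of \<open>f\<close> fill an interval determined by
  \<open>f\<close> alone, and different values have disjoint intervals. So a rank reveals the value
  however ties are broken.\<close>

lemma sorting_perms_same_value:
  assumes "\<rho> \<in> sorting_perms n f" "\<rho>' \<in> sorting_perms n f"
    and "p \<in> {1..n}" "q \<in> {1..n}" "\<rho> p = \<rho>' q"
  shows "f p = f q"
proof -
  have not_less: "\<not> f p < f q"
    if "\<rho> \<in> sorting_perms n f" "\<rho>' \<in> sorting_perms n f" "p \<in> {1..n}" "q \<in> {1..n}" "\<rho> p = \<rho>' q" for \<rho> \<rho>' p q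
  proof
    assume "f p < f q"
    have "\<rho> p \<le> card {r \<in> {1..n}. f r \<le> f p}"
      by (rule sorting_perm_bounds) fact+
    also have "\<dots> \<le> card {r \<in> {1..n}. f r < f q}"
      using \<open>f p < f q\<close> by (intro card_mono) auto
    also have "\<dots> < \<rho>' q"
      by (rule sorting_perm_bounds) fact+
    finally show False
      using that by simp
  qed
  show ?thesis
    using not_less[OF assms] not_less[OF assms(2,1,4,3) assms(5)[symmetric]] by simp
qed

text \<open>
  Permutations \<open>\<rho>\<close> with a common rearrangement \<open>f \<circ> inv \<rho>\<close> form a coset of the stabiliser
  of \<open>f\<close>, and so do the sorting permutations. There are at most \<open>M ^ n\<close> rearrangements.
\<close>

lemma fact_le_card_sorting_perms:
  assumes f: "\<And>p. p \<in> {1..n} \<Longrightarrow> f p < M"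
  shows "fact n \<le> M ^ n * card (sorting_perms n f)"
proof -
  let ?P = "{\<rho>. \<rho> permutes {1..n}}"
  let ?h = "\<lambda>\<rho>. \<lambda>c\<in>{1..n}. f (inv \<rho> c)"
  have "card ?P \<le> card (grid {1..n} M) * card (sorting_perms n f)"
  proof (rule card_le_card_mult_fibres[where f = ?h])
    show "?h ` ?P \<subseteq> grid {1..n} M"
    proof (rule image_subsetI)
      fix \<rho> assume "\<rho> \<in> ?P"
      then have "f (inv \<rho> c) < M" if "c \<in> {1..n}" for c
        using that permutes_in_image[OF permutes_inv, of \<rho> "{1..n}" c] by (intro f) simp
      then show "?h \<rho> \<in> grid {1..n} M"
        by auto
    qed
    fix y
    show "card {\<rho> \<in> ?P. ?h \<rho> = y} \<le> card (sorting_perms n f)"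
    proof (cases "{\<rho> \<in> ?P. ?h \<rho> = y} = {}")
      case True
      then show ?thesis
        by (simp only: card.empty le0)
    next
      case False
      then obtain \<rho>' where \<rho>': "\<rho>' permutes {1..n}" "?h \<rho>' = y"
        by blast
      obtain \<rho>0 where \<rho>0: "\<rho>0 \<in> sorting_perms n f"
        using sorting_perms_nonempty by blast
      show ?thesis
      proof (rule card_inj_on_le)
        show "inj_on (\<lambda>\<rho>. \<rho>0 \<circ> inv \<rho> \<circ> \<rho>') {\<rho> \<in> ?P. ?h \<rho> = y}"
        proof (rule inj_onI)
          fix \<rho> \<pi> assume perms: "\<rho> \<in> {\<rho> \<in> ?P. ?h \<rho> = y}" "\<pi> \<in> {\<rho> \<in> ?P. ?h \<rho> = y}"
            and eq: "\<rho>0 \<circ> inv \<rho> \<circ> \<rho>' = \<rho>0 \<circ> inv \<pi> \<circ> \<rho>'"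
          have inj: "inj \<rho>0"
            using \<rho>0 permutes_inj[of \<rho>0 "{1..n}"] by (simp add: sorting_perms_def)
          have "inv \<rho> c = inv \<pi> c" for c
            using fun_cong[OF eq, of "inv \<rho>' c"] permutes_inverses(1)[OF \<rho>'(1)] by (simp add: inj_eq[OF inj])
          then have "inv \<rho> = inv \<pi>"
            by (rule ext)
          then have "inv (inv \<rho>) = inv (inv \<pi>)"
            by (rule arg_cong)
          moreover have "inv (inv \<rho>) = \<rho>" "inv (inv \<pi>) = \<pi>"
            using perms by (auto intro: permutes_inv_inv)
          ultimately show "\<rho> = \<pi>"
            by (simp only:)
        qed
        show "(\<lambda>\<rho>. \<rho>0 \<circ> inv \<rho> \<circ> \<rho>') ` {\<rho> \<in> ?P. ?h \<rho> = y} \<subseteq> sorting_perms n f"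
        proof (rule image_subsetI)
          fix \<rho> assume \<rho>: "\<rho> \<in> {\<rho> \<in> ?P. ?h \<rho> = y}"
          then have perm: "\<rho> permutes {1..n}" and eq: "?h \<rho> = ?h \<rho>'"
            using \<rho>'(2) by auto
          \<comment> \<open>Since \<open>\<rho>\<close> and \<open>\<rho>'\<close> share the
            rearrangement \<open>y\<close>, \<open>g\<close> preserves \<open>f\<close> on
            \<open>{1..n}\<close>, and \<open>\<rho>0 \<circ> g\<close> sorts as
            \<open>\<rho>0\<close> does.\<close>
          define g where "g = inv \<rho> \<circ> \<rho>'"
          have g: "g permutes {1..n}"
            unfolding g_def using permutes_compose[OF \<rho>'(1) permutes_inv[OF perm]] .
          have "f (g p) = f p" if "p \<in> {1..n}" for p
            using fun_cong[OF eq, of "\<rho>' p"] that permutes_in_image[OF \<rho>'(1), of p] permutes_inverses(2)[OF \<rho>'(1)]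
            by (simp add: g_def)
          moreover have "\<rho>0 permutes {1..n}"
            using \<rho>0 by (simp add: sorting_perms_def)
          ultimately have "\<rho>0 \<circ> g \<in> sorting_perms n f"
            using \<rho>0 permutes_compose[OF g] permutes_in_image[OF g] by (auto simp: sorting_perms_def)
          then show "\<rho>0 \<circ> inv \<rho> \<circ> \<rho>' \<in> sorting_perms n f"
            by (simp add: g_def comp_assoc)
        qed
      qed (rule finite_sorting_perms)
    qed
  qed (auto intro: finite_permutations finite_grid)
  then show ?thesis
    by (simp add: card_permutations card_grid)
qed

text \<open>
  The points \<open>1, \<dots>, n\<close> carry cell coordinates \<open>f 0, \<dots>, f d\<close>. Sorting them in each coordinate
  direction and breaking ties arbitrarily yields a tuple of permutations; as the cells form an
  antichain, the first two entries of the pattern never occur, and the cells can be recovered.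
\<close>

lemma prod_card_sorting_perms_le_num_avoiding:
  assumes m: "m > 1" and \<sigma>: "\<sigma> \<in> perm_tuples d m"
    and anti: "\<And>p q. p \<in> {1..n} \<Longrightarrow> q \<in> {1..n} \<Longrightarrow> f 0 p \<le> f 0 q \<Longrightarrow>
      (\<And>i. i \<in> {1..d} \<Longrightarrow> if \<sigma> i 1 < \<sigma> i 2 then f i p \<le> f i q else f i q \<le> f i p) \<Longrightarrow> p = q"
  shows "(\<Prod>i\<in>{0..d}. card (sorting_perms n (f i))) \<le> num_avoiding d n m \<sigma>"
proof -
  let ?R = "\<Pi>\<^sub>E i\<in>{0..d}. sorting_perms n (f i)"
  \<comment> \<open>Point \<open>p\<close> sits at position \<open>\<rho> 0 p\<close>, where the
    \<open>i\<close>-th permutation takes the value \<open>\<rho> i p\<close>.\<close>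
  let ?T = "\<lambda>\<rho>. \<lambda>i\<in>{1..d}. \<rho> i \<circ> inv (\<rho> 0)"
  have perm: "\<rho> i permutes {1..n}" if "\<rho> \<in> ?R" "i \<in> {0..d}" for \<rho> i
    using PiE_mem[OF that] by (simp add: sorting_perms_def)
  have le: "f i p \<le> f i q" if "\<rho> \<in> ?R" "i \<in> {0..d}" "p \<in> {1..n}" "q \<in> {1..n}" "\<rho> i p < \<rho> i q" for \<rho> i p q
    using PiE_mem[OF that(1,2)] that(3-5) by (force simp: sorting_perms_def not_less[symmetric])
  have "card ?R \<le> card {\<tau> \<in> perm_tuples d n. \<not> contains_in_parallel d n \<tau> m \<sigma>}"
  proof (rule card_inj_on_le)
    show "inj_on ?T ?R"
    proof (rule inj_onI)
      fix \<rho> \<pi> assume \<rho>: "\<rho> \<in> ?R" and \<pi>: "\<pi> \<in> ?R" and eq: "?T \<rho> = ?T \<pi>"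
      \<comment> \<open>\<open>g\<close> matches the points at equal positions. Equal tuples give
        them equal ranks, hence equal cell coordinates, in all directions, so \<open>anti\<close>
        makes \<open>g\<close> the identity.\<close>
      define g where "g = inv (\<pi> 0) \<circ> \<rho> 0"
      have perms: "\<rho> 0 permutes {1..n}" "\<pi> 0 permutes {1..n}"
        using perm \<rho> \<pi> by auto
      have g: "g permutes {1..n}"
        unfolding g_def using permutes_compose[OF perms(1) permutes_inv[OF perms(2)]] .
      have \<pi>g: "\<pi> i (g p) = \<rho> i p" if "i \<in> {0..d}" for i p
      proof (cases "i = 0")
        case True
        then show ?thesis
          using permutes_inverses(1)[OF perms(2)] by (simp add: g_def)
      next
        case False
        then have "\<rho> i \<circ> inv (\<rho> 0) = \<pi> i \<circ> inv (\<pi> 0)"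
          using fun_cong[OF eq, of i] that by auto
        then have "(\<rho> i \<circ> inv (\<rho> 0)) (\<rho> 0 p) = (\<pi> i \<circ> inv (\<pi> 0)) (\<rho> 0 p)"
          by (rule arg_cong[where f = "\<lambda>h. h (\<rho> 0 p)"])
        then show ?thesis
          using permutes_inverses(2)[OF perms(1)] by (simp add: g_def)
      qed
      have "g p = p" for p
      proof (cases "p \<in> {1..n}")
        case True
        then have gp: "g p \<in> {1..n}"
          using permutes_in_image[OF g] by blast
        have "f i (g p) = f i p" if "i \<in> {0..d}" for i
          using sorting_perms_same_value[OF PiE_mem[OF \<pi> that] PiE_mem[OF \<rho> that] gp True \<pi>g[OF that]] .
        then show ?thesis
          by (intro anti[OF gp True]) auto
      next
        case False
        then show ?thesis
          using permutes_not_in[OF g] by blast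
      qed
      then have "\<rho> i = \<pi> i" if "i \<in> {0..d}" for i
        using \<pi>g[OF that] by auto
      then show "\<rho> = \<pi>"
        by (rule PiE_ext[OF \<rho> \<pi>])
    qed
    show "?T ` ?R \<subseteq> {\<tau> \<in> perm_tuples d n. \<not> contains_in_parallel d n \<tau> m \<sigma>}"
    proof (rule image_subsetI)
      fix \<rho> assume \<rho>: "\<rho> \<in> ?R"
      have perm0: "\<rho> 0 permutes {1..n}"
        using perm \<rho> by auto
      have "?T \<rho> \<in> perm_tuples d n"
        unfolding perm_tuples_def
        using perm[OF \<rho>] permutes_compose[OF permutes_inv[OF perm0]] by auto
      moreover have "\<not> contains_in_parallel d n (?T \<rho>) m \<sigma>"
      proof
        assume "contains_in_parallel d n (?T \<rho>) m \<sigma>"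
        then obtain c where c: "strict_mono_on {1..m} c" "c ` {1..m} \<subseteq> {1..n}"
            "\<And>i. i \<in> {1..d} \<Longrightarrow> order_isomorphic m (\<lambda>j. ?T \<rho> i (c j)) (\<sigma> i)"
          unfolding contains_in_parallel_def by blast
        \<comment> \<open>The points at the positions of the first two pattern entries; their cells
          are comparable in just the way that \<open>anti\<close> excludes for distinct
          points.\<close>
        define p q where "p = inv (\<rho> 0) (c 1)" and "q = inv (\<rho> 0) (c 2)"
        have "c 1 \<in> {1..n}" "c 2 \<in> {1..n}"
          using c(2) m by (auto simp: image_subset_iff)
        then have p: "p \<in> {1..n}" and q: "q \<in> {1..n}"
          using permutes_in_image[OF permutes_inv[OF perm0]] by (auto simp: p_def q_def)
        have \<rho>0: "\<rho> 0 p < \<rho> 0 q"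
          using m permutes_inverses(1)[OF perm0] strict_mono_onD[OF c(1), of 1 2] by (simp add: p_def q_def)
        have "if \<sigma> i 1 < \<sigma> i 2 then f i p \<le> f i q else f i q \<le> f i p" if i: "i \<in> {1..d}" for i
        proof -
          have iso: "\<rho> i p < \<rho> i q \<longleftrightarrow> \<sigma> i 1 < \<sigma> i 2" "\<rho> i q < \<rho> i p \<longleftrightarrow> \<sigma> i 2 < \<sigma> i 1"
            using c(3)[OF i] i m by (auto simp: order_isomorphic_def p_def q_def)
          have "\<sigma> i 1 \<noteq> \<sigma> i 2"
            using permutes_inj[OF perm_tuplesD[OF \<sigma> i]] by (simp add: inj_eq)
          then show ?thesis
            using iso le[OF \<rho>, of i p q] le[OF \<rho>, of i q p] p q i by auto
        qed
        then have "p = q"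
          using le[OF \<rho> _ p q \<rho>0] p q by (intro anti) auto
        with \<rho>0 show False
          by simp
      qed
      ultimately show "?T \<rho> \<in> {\<tau> \<in> perm_tuples d n. \<not> contains_in_parallel d n \<tau> m \<sigma>}"
        by simp
    qed
    show "finite {\<tau> \<in> perm_tuples d n. \<not> contains_in_parallel d n \<tau> m \<sigma>}"
      unfolding perm_tuples_def
      by (rule finite_subset[OF _ finite_PiE[of "{1..d}" "\<lambda>_. {p. p permutes {1..n}}"]])
         (auto intro: finite_permutations)
  qed
  then show ?thesis
    by (simp add: card_PiE num_avoiding_def)
qed

section \<open>Choice of the antichain and the lower bound\<close>

lemma fact_power_le_num_avoiding:
  assumes m: "m > 1" and \<sigma>: "\<sigma> \<in> perm_tuples d m" and n: "n \<le> K ^ d"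
  shows "fact n ^ (d + 1) \<le> ((d * K + 1) ^ n) ^ (d + 1) * num_avoiding d n m \<sigma>"
proof -
  have "card {1..n} \<le> card (grid {1..d} K)"
    using n by (simp add: card_grid)
  then obtain \<phi> where \<phi>: "\<phi> ` {1..n} \<subseteq> grid {1..d} K" "inj_on \<phi> {1..n}"
    using card_le_inj[of "{1..n}" "grid {1..d} K"] finite_grid[of "{1..d}" K] by auto
  have \<phi>_less: "\<phi> p i < K" if "p \<in> {1..n}" "i \<in> {1..d}" for p i
    using \<phi>(1) that by (auto simp: PiE_iff image_subset_iff)
  \<comment> \<open>A direction is reversed where the pattern does not start with an ascent.
    Coordinate 0 is \<open>d * K\<close> minus the coordinate sum of \<open>\<phi> p\<close>, so it
    must drop whenever some coordinate of \<open>\<phi> p\<close> grows and none decreases.\<close>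
  define f where "f i p = (if i = 0 then \<Sum>j\<in>{1..d}. K - \<phi> p j
      else if \<sigma> i 1 < \<sigma> i 2 then \<phi> p i else K - \<phi> p i)" for i p
  have bound: "f i p < d * K + 1" if "i \<in> {0..d}" "p \<in> {1..n}" for i p
  proof (cases "i = 0")
    case True
    have "(\<Sum>j\<in>{1..d}. K - \<phi> p j) \<le> (\<Sum>j\<in>{1..d}. K)"
      by (rule sum_mono) simp
    then show ?thesis
      using True by (simp add: f_def)
  next
    case False
    then have "f i p \<le> K"
      using \<phi>_less[OF that(2), of i] that(1) by (auto simp: f_def)
    also have "K \<le> d * K"
      using False that(1) by simp
    finally show ?thesis
      by simp
  qed
  have anti: "p = q" if p: "p \<in> {1..n}" and q: "q \<in> {1..n}" and zero: "f 0 p \<le> f 0 q"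
    and le: "\<And>i. i \<in> {1..d} \<Longrightarrow> if \<sigma> i 1 < \<sigma> i 2 then f i p \<le> f i q else f i q \<le> f i p" for p q
  proof -
    have mono: "\<phi> p i \<le> \<phi> q i" if "i \<in> {1..d}" for i
      using le[OF that] that \<phi>_less[OF p that] \<phi>_less[OF q that] by (auto simp: f_def split: if_splits)
    have "\<phi> p i = \<phi> q i" if i: "i \<in> {1..d}" for i
    proof (rule ccontr)
      assume "\<phi> p i \<noteq> \<phi> q i"
      then have "K - \<phi> q i < K - \<phi> p i"
        using mono[OF i] \<phi>_less[OF q i] by auto
      then have "(\<Sum>j\<in>{1..d}. K - \<phi> q j) < (\<Sum>j\<in>{1..d}. K - \<phi> p j)"
        using i mono by (intro sum_strict_mono_ex1) (auto intro: diff_le_mono2)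
      with zero show False
        by (simp add: f_def)
    qed
    then have "\<phi> p = \<phi> q"
      by (rule PiE_ext[OF subsetD[OF \<phi>(1) imageI[OF p]] subsetD[OF \<phi>(1) imageI[OF q]]])
    then show ?thesis
      using inj_onD[OF \<phi>(2)] p q by blast
  qed
  have "fact n ^ (d + 1) = (\<Prod>i\<in>{0..d}. fact n :: nat)"
    by simp
  also have "\<dots> \<le> (\<Prod>i\<in>{0..d}. (d * K + 1) ^ n * card (sorting_perms n (f i)))"
    by (rule prod_mono) (use fact_le_card_sorting_perms bound in auto)
  also have "\<dots> = ((d * K + 1) ^ n) ^ (d + 1) * (\<Prod>i\<in>{0..d}. card (sorting_perms n (f i)))"
    by (simp add: prod.distrib)
  also have "\<dots> \<le> ((d * K + 1) ^ n) ^ (d + 1) * num_avoiding d n m \<sigma>"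
    by (intro mult_le_mono2 prod_card_sorting_perms_le_num_avoiding[OF m \<sigma>] anti)
  finally show ?thesis .
qed

lemma num_avoiding_lower:
  assumes m: "m > 1" and d: "d \<ge> 1" and \<sigma>: "\<sigma> \<in> perm_tuples d m"
  shows "\<exists>c>0. \<forall>n\<ge>1. c ^ n * real n powr (real n * ((real d ^ 2 - 1) / real d)) \<le> real (num_avoiding d n m \<sigma>)"
proof -
  \<comment> \<open>Chosen so that \<open>b * x * (exp 1 * M) \<le> n\<close>, given
    \<open>r * x = n\<close> and \<open>M \<le> 2 * (d + 1) * r\<close>; the factor
    \<open>exp 1\<close> pays for replacing \<open>n ^ n\<close> by \<open>fact n\<close>.\<close>
  define b :: real where "b = 1 / (exp 1 * (2 * (real d + 1)))"
  have b: "b > 0"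
    by (simp add: b_def add_pos_nonneg)
  show ?thesis
  proof (intro exI[of _ "b ^ (d + 1)"] conjI allI impI)
    show "b ^ (d + 1) > 0"
      using b by simp
    fix n :: nat assume n: "n \<ge> 1"
    define r where "r = real n powr (1 / real d)"
    define x where "x = real n powr (1 - 1 / real d)"
    obtain e where e: "n \<le> (2 ^ e) ^ d" "2 ^ e \<le> 2 * r"
      using dyadic_root[OF d n] unfolding r_def .
    define M where "M = d * 2 ^ e + 1"
    have r: "r > 0"
      using n by (simp add: r_def)
    have "real M \<le> (real d + 1) * 2 ^ e"
      by (simp add: M_def algebra_simps)
    also have "\<dots> \<le> (real d + 1) * (2 * r)"
      using e(2) by (intro mult_left_mono) auto
    finally have M: "real M \<le> 2 * (real d + 1) * r"
      by (simp add: algebra_simps)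
    have "r * x = real n"
      using n by (simp add: r_def x_def flip: powr_add)
    then have "b * x * (exp 1 * (2 * (real d + 1) * r)) = real n"
      by (simp add: b_def add_nonneg_eq_0_iff mult.commute)
    then have "b * x * (exp 1 * real M) \<le> real n"
      using M b by (metis mult_left_mono exp_ge_zero mult_nonneg_nonneg less_imp_le powr_ge_zero x_def)
    then have "(b * x * (exp 1 * real M)) ^ n \<le> real n ^ n"
      using b by (intro power_mono) (auto simp: x_def)
    also have "\<dots> \<le> exp (real n) * fact n"
      by (rule power_self_le_exp_fact)
    finally have "(b * x) ^ n * real M ^ n \<le> fact n"
      using exp_of_nat_mult[of n "1 :: real"] by (simp add: power_mult_distrib)
    then have "((b * x) ^ n * real M ^ n) ^ (d + 1) \<le> fact n ^ (d + 1)"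
      using b by (intro power_mono) (auto simp: x_def)
    also have "\<dots> = real (fact n ^ (d + 1))"
      by simp
    also have "\<dots> \<le> real ((M ^ n) ^ (d + 1) * num_avoiding d n m \<sigma>)"
      using fact_power_le_num_avoiding[OF m \<sigma> e(1)] unfolding M_def of_nat_le_iff .
    also have "\<dots> = (real M ^ n) ^ (d + 1) * real (num_avoiding d n m \<sigma>)"
      by simp
    finally have "(real M ^ n) ^ (d + 1) * ((b * x) ^ n) ^ (d + 1) \<le> (real M ^ n) ^ (d + 1) * real (num_avoiding d n m \<sigma>)"
      by (simp only: power_mult_distrib mult.commute)
    moreover have "(real M ^ n) ^ (d + 1) > 0"
      by (simp add: M_def add_pos_nonneg)
    ultimately have "((b * x) ^ n) ^ (d + 1) \<le> real (num_avoiding d n m \<sigma>)"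
      by (simp only: mult_le_cancel_left_pos)
    also have "((b * x) ^ n) ^ (d + 1) = (b ^ (d + 1)) ^ n * x ^ ((d + 1) * n)"
      by (metis mult.commute power_mult power_mult_distrib)
    finally show "(b ^ (d + 1)) ^ n * real n powr (real n * ((real d ^ 2 - 1) / real d))
        \<le> real (num_avoiding d n m \<sigma>)"
      unfolding x_def root_power_eq[OF d n] .
  qed
qed

theorem theorem3p5:
  fixes m d :: nat and \<sigma> :: "nat \<Rightarrow> nat \<Rightarrow> nat"
  assumes "m > 1" and "d \<ge> 1" and "\<sigma> \<in> perm_tuples d m"
  shows "\<exists>c1 c2 :: real. c2 > c1 \<and> c1 > 0 \<and>
    (\<forall>n :: nat. n > 0 \<longrightarrow>
       c1 ^ n * real n powr (real n * ((real d ^ 2 - 1) / real d)) \<le> real (num_avoiding d n m \<sigma>) \<and>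
       real (num_avoiding d n m \<sigma>) \<le> c2 ^ n * real n powr (real n * ((real d ^ 2 - 1) / real d)))"
proof -
  let ?E = "\<lambda>n. real n powr (real n * ((real d ^ 2 - 1) / real d))"
  obtain c1 where c1: "c1 > 0" "\<forall>n\<ge>1. c1 ^ n * ?E n \<le> real (num_avoiding d n m \<sigma>)"
    using num_avoiding_lower[OF assms] by blast
  obtain c where c: "c \<ge> 0" "\<forall>n\<ge>1. real (num_avoiding d n m \<sigma>) \<le> c ^ n * ?E n"
    using num_avoiding_upper[OF assms(2,3)] by blast
  \<comment> \<open>The sum \<open>c + c1 + 1\<close> dominates \<open>c\<close> and strictly
    exceeds \<open>c1\<close>.\<close>
  show ?thesis
  proof (rule exI[of _ c1], rule exI[of _ "c + c1 + 1"], intro conjI allI impI)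
    fix n :: nat assume "n > 0"
    then have n: "n \<ge> 1"
      by simp
    then show "c1 ^ n * ?E n \<le> real (num_avoiding d n m \<sigma>)"
      using c1 by blast
    have "real (num_avoiding d n m \<sigma>) \<le> c ^ n * ?E n"
      using c n by blast
    also have "\<dots> \<le> (c + c1 + 1) ^ n * ?E n"
      using c c1 by (intro mult_right_mono power_mono) auto
    finally show "real (num_avoiding d n m \<sigma>) \<le> (c + c1 + 1) ^ n * ?E n" .
  qed (use c c1 in auto)
qed

end
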